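(* Let $p\in[1,\infty)$ with Hölder conjugate $p'$, and let $\overline{\mathcal{D}_\delta}$ act on $L^{p'}(\Omega_\delta)$. Define an operator $\overline{\mathcal{D}_\delta}^*$ on $L^p(\Omega_\delta)$ by $$\overline{\mathcal{D}_\delta}^*u(x)=\int_{\Omega_\delta}u(y)\,\mu_\delta(x-y)\,\chi_{B_\delta(x)}(y)\,\chi_\Omega(y)\,dy-u(x)\,\chi_\Omega(x)\int_{B_\delta(0)}\mu_\delta(z)\,dz.$$ Then $\overline{\mathcal{D}_\delta}^*$ is a bounded linear operator on $L^p(\Omega_\delta)$, and it is the adjoint of $\overline{\mathcal{D}_\delta}$ in the sense that $\langle\overline{\mathcal{D}_\delta}^*u,v\rangle=\langle u,\overline{\mathcal{D}_\delta}v\rangle$ for all $u\in L^p(\Omega_\delta)$ and all $v\in L^{p'}(\Omega_\delta)$.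
   Context: $\Omega\subseteq\mathbb{R}^d$ is open and bounded, $\delta>0$, and $\mu_\delta\in L^1(\mathbb{R}^d)$ is a real-valued kernel with $\operatorname{supp}(\mu_\delta)\subseteq\overline{B_\delta(0)}$ (no symmetry is assumed). The collar is $\Gamma_\delta=\left(\bigcup_{x\in\Omega}\overline{B_\delta(x)}\right)\setminus\Omega$, and $\Omega_\delta=\Omega\cup\Gamma_\delta$. $\chi_A$ is the characteristic function of $A$. The extended nonlocal derivative is, for $u$ on $\Omega_\delta$ and $x\in\Omega_\delta$, $$\overline{\mathcal{D}_\delta}u(x)=\int_{\Omega_\delta}[u(y)-u(x)]\,\mu_\delta(y-x)\,\chi_{B_\delta(x)}(y)\,\chi_\Omega(x)\,dy,$$ so $\overline{\mathcal{D}_\delta}u=0$ on $\Gamma_\delta$. Functions are real-valued, and the duality pairing $L^p(\Omega_\delta)\times L^{p'}(\Omega_\delta)\to\mathbb{R}$ is $\langle u,v\rangle=\int_{\Omega_\delta}u(x)v(x)\,dx$. *)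

theory Defs
  imports "HOL-Analysis.Analysis" "HOL-Probability.Essential_Supremum"
begin

section \<open>Lebesgue spaces\<close>

text \<open>
  Elements of \<open>L\<^sup>p\<close> are represented by functions; statements about classes are made
  modulo equality almost everywhere.  The exponent ranges over \<open>[1,\<infinity>]\<close>; the definitions
  are only meant for \<open>p \<ge> 1\<close>.
\<close>

definition Lp :: "'a measure \<Rightarrow> ennreal \<Rightarrow> ('a \<Rightarrow> real) set" where
  "Lp M p =
    (if p = \<infinity> then {f \<in> borel_measurable M. esssup M (\<lambda>x. ennreal \<bar>f x\<bar>) < \<infinity>}
     else {f \<in> borel_measurable M. integrable M (\<lambda>x. \<bar>f x\<bar> powr enn2real p)})"

definition Lp_norm :: "'a measure \<Rightarrow> ennreal \<Rightarrow> ('a \<Rightarrow> real) \<Rightarrow> real" where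
  "Lp_norm M p f =
    (if p = \<infinity> then enn2real (esssup M (\<lambda>x. ennreal \<bar>f x\<bar>))
     else (LINT x|M. \<bar>f x\<bar> powr enn2real p) powr (1 / enn2real p))"

text \<open>\<open>T\<close> induces a map on the almost-everywhere equivalence classes of \<open>L\<^sup>p\<close>.\<close>

definition operator_on_Lp ::
  "'a measure \<Rightarrow> ennreal \<Rightarrow> (('a \<Rightarrow> real) \<Rightarrow> 'a \<Rightarrow> real) \<Rightarrow> bool" where
  "operator_on_Lp M p T \<longleftrightarrow>
    (\<forall>u\<in>Lp M p. T u \<in> Lp M p) \<and>
    (\<forall>u\<in>Lp M p. \<forall>v\<in>Lp M p. (AE x in M. u x = v x) \<longrightarrow> (AE x in M. T u x = T v x))"

definition bounded_linear_on_Lp ::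
  "'a measure \<Rightarrow> ennreal \<Rightarrow> (('a \<Rightarrow> real) \<Rightarrow> 'a \<Rightarrow> real) \<Rightarrow> bool" where
  "bounded_linear_on_Lp M p T \<longleftrightarrow>
    operator_on_Lp M p T \<and>
    (\<forall>u\<in>Lp M p. \<forall>v\<in>Lp M p. AE x in M. T (\<lambda>y. u y + v y) x = T u x + T v x) \<and>
    (\<forall>c. \<forall>u\<in>Lp M p. AE x in M. T (\<lambda>y. c * u y) x = c * T u x) \<and>
    (\<exists>C. \<forall>u\<in>Lp M p. Lp_norm M p (T u) \<le> C * Lp_norm M p u)"

text \<open>
  The support of a class of measurable functions: the complement of the largest open set on
  which the function vanishes almost everywhere.
\<close>

definition ess_support :: "('a::euclidean_space \<Rightarrow> real) \<Rightarrow> 'a set" where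
  "ess_support f = - \<Union>{U. open U \<and> (AE x in lebesgue. x \<in> U \<longrightarrow> f x = 0)}"

section \<open>The extended nonlocal derivative\<close>

definition collar :: "real \<Rightarrow> 'a::euclidean_space set \<Rightarrow> 'a set" where
  "collar \<delta> \<Omega> = (\<Union>x\<in>\<Omega>. cball x \<delta>) - \<Omega>"

definition ext_domain :: "real \<Rightarrow> 'a::euclidean_space set \<Rightarrow> 'a set" where
  "ext_domain \<delta> \<Omega> = \<Omega> \<union> collar \<delta> \<Omega>"

text \<open>
  The integrands are named separately because the Bochner integral of a non-integrable
  function is \<open>0\<close>: existence of the integrals has to be stated explicitly.
\<close>

definition nl_deriv_integrand ::
  "real \<Rightarrow> ('a \<Rightarrow> real) \<Rightarrow> 'a::euclidean_space set \<Rightarrow> ('a \<Rightarrow> real) \<Rightarrow> 'a \<Rightarrow> 'a \<Rightarrow> real" where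
  "nl_deriv_integrand \<delta> \<mu> \<Omega> u x y =
    (u y - u x) * \<mu> (y - x) * indicator (ball x \<delta>) y * indicator \<Omega> x"

definition nl_deriv ::
  "real \<Rightarrow> ('a \<Rightarrow> real) \<Rightarrow> 'a::euclidean_space set \<Rightarrow> ('a \<Rightarrow> real) \<Rightarrow> 'a \<Rightarrow> real" where
  "nl_deriv \<delta> \<mu> \<Omega> u x =
    (LINT y|lebesgue_on (ext_domain \<delta> \<Omega>). nl_deriv_integrand \<delta> \<mu> \<Omega> u x y)"

definition nl_adj_integrand ::
  "real \<Rightarrow> ('a \<Rightarrow> real) \<Rightarrow> 'a::euclidean_space set \<Rightarrow> ('a \<Rightarrow> real) \<Rightarrow> 'a \<Rightarrow> 'a \<Rightarrow> real" where
  "nl_adj_integrand \<delta> \<mu> \<Omega> u x y =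
    u y * \<mu> (x - y) * indicator (ball x \<delta>) y * indicator \<Omega> y"

definition nl_adj ::
  "real \<Rightarrow> ('a \<Rightarrow> real) \<Rightarrow> 'a::euclidean_space set \<Rightarrow> ('a \<Rightarrow> real) \<Rightarrow> 'a \<Rightarrow> real" where
  "nl_adj \<delta> \<mu> \<Omega> u x =
    (LINT y|lebesgue_on (ext_domain \<delta> \<Omega>). nl_adj_integrand \<delta> \<mu> \<Omega> u x y)
    - u x * indicator \<Omega> x * (LINT z|lebesgue_on (ball 0 \<delta>). \<mu> z)"

end

theory Submission
  imports Defs
begin

text \<open>
  Write \<open>k = \<mu> \<chi>\<close> with \<open>\<chi>\<close> the indicator of the open ball of radius \<open>\<delta>\<close> around \<open>0\<close>, write
  \<open>c\<close> for the integral of \<open>k\<close>, \<open>k'(z) = k(-z)\<close>, and \<open>S\<close> for the extended domain.  Both operators are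
  convolutions minus a multiple of the identity, up to cutting off with indicator functions:
  the adjoint candidate sends \<open>u\<close> to \<open>k * u\<^sub>0 - c u\<^sub>0\<close> with \<open>u\<^sub>0 = u 1\<^sub>\<Omega>\<close>, and the derivative sends
  \<open>v\<close> to \<open>1\<^sub>\<Omega> (k' * v\<^sub>0 - c v\<^sub>0)\<close> with \<open>v\<^sub>0 = v 1\<^sub>S\<close> (lemmas \<open>nl_adj_eq\<close> and \<open>nl_deriv_eq_AE\<close>).  The second
  formula uses that the ball around a point of \<open>\<Omega>\<close> lies inside \<open>S\<close>, so that integrating the kernel
  over \<open>S\<close> always yields the full mass \<open>c\<close>.

  Since \<open>k\<close> is integrable, Young's inequality bounds convolution with \<open>k\<close> on every \<open>L\<^sup>p\<close>,
  \<open>1 \<le> p \<le> \<infinity>\<close>, by the \<open>L\<^sup>1\<close> norm of \<open>k\<close> (\<open>convolution_Lp\<close>, \<open>Young_le\<close>).  This gives existence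
  of the integrals and the mapping properties of both operators.  For finite \<open>p\<close> it is
  obtained from the case \<open>p = 1\<close>, which is Tonelli's theorem, by applying Jensen's inequality to the weight
  \<open>y \<mapsto> \<bar>k(x - y)\<bar>\<close>.

  The adjoint relation is Fubini's theorem for \<open>k(x - y) u\<^sub>0(y) v\<^sub>0(x)\<close>, which is integrable on the
  product because \<open>\<bar>k\<bar> * \<bar>u\<^sub>0\<bar>\<close> is in \<open>L\<^sup>p\<close> and \<open>v\<^sub>0\<close> in the conjugate space
  (\<open>convolution_duality\<close>, \<open>Lp_pairing_integrable\<close>); the terms with \<open>c\<close> agree because both equal
  \<open>c\<close> times the integral of \<open>u\<^sub>0 v\<^sub>0\<close>.
\<close>

section \<open>Lebesgue spaces\<close>

lemma Lp_finite_iff: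
  assumes "p \<noteq> \<infinity>"
  shows "f \<in> Lp M p \<longleftrightarrow> f \<in> borel_measurable M \<and> integrable M (\<lambda>x. \<bar>f x\<bar> powr enn2real p)"
  using assms by (simp add: Lp_def)

lemma Lp_top_iff:
  "f \<in> Lp M \<infinity> \<longleftrightarrow> f \<in> borel_measurable M \<and> (\<exists>C\<ge>0. AE x in M. \<bar>f x\<bar> \<le> C)"
proof safe
  assume f: "f \<in> Lp M \<infinity>"
  then show "f \<in> borel_measurable M"
    by (simp add: Lp_def)
  let ?E = "esssup M (\<lambda>x. ennreal \<bar>f x\<bar>)"
  have "?E < \<infinity>"
    using f by (simp add: Lp_def)
  then have "ennreal (enn2real ?E) = ?E"
    by simp
  moreover have "AE x in M. ennreal \<bar>f x\<bar> \<le> ?E"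
    by (rule esssup_AE)
  ultimately have "AE x in M. \<bar>f x\<bar> \<le> enn2real ?E"
    by (metis (no_types, lifting) ennreal_le_iff enn2real_nonneg AE_mp AE_I2)
  then show "\<exists>C\<ge>0. AE x in M. \<bar>f x\<bar> \<le> C"
    using enn2real_nonneg by blast
next
  fix C :: real
  assume [measurable]: "f \<in> borel_measurable M" and C: "0 \<le> C" "AE x in M. \<bar>f x\<bar> \<le> C"
  have "esssup M (\<lambda>x. ennreal \<bar>f x\<bar>) \<le> ennreal C"
    using C by (intro esssup_I) (auto intro: ennreal_leI)
  then show "f \<in> Lp M \<infinity>"
    by (auto simp: Lp_def top_unique less_top[symmetric])
qed

lemma Lp_measurable: "f \<in> Lp M p \<Longrightarrow> f \<in> borel_measurable M"
  by (auto simp: Lp_def split: if_splits)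

lemma Lp_dominated:
  assumes g: "g \<in> Lp M p" and f: "f \<in> borel_measurable M" and le: "AE x in M. \<bar>f x\<bar> \<le> \<bar>g x\<bar>"
  shows "f \<in> Lp M p"
proof (cases "p = \<infinity>")
  case True
  with g obtain C where "0 \<le> C" "AE x in M. \<bar>g x\<bar> \<le> C"
    by (auto simp: Lp_top_iff simp del: infinity_ennreal_def)
  moreover from this(2) le have "AE x in M. \<bar>f x\<bar> \<le> C"
    by eventually_elim simp
  ultimately show ?thesis
    using f True by (auto simp: Lp_top_iff simp del: infinity_ennreal_def)
next
  case False
  have "integrable M (\<lambda>x. \<bar>f x\<bar> powr enn2real p)"
  proof (rule Bochner_Integration.integrable_bound)
    show "integrable M (\<lambda>x. \<bar>g x\<bar> powr enn2real p)"
      using g False by (simp add: Lp_finite_iff)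
    show "(\<lambda>x. \<bar>f x\<bar> powr enn2real p) \<in> borel_measurable M"
      using f by measurable
    show "AE x in M. norm (\<bar>f x\<bar> powr enn2real p) \<le> norm (\<bar>g x\<bar> powr enn2real p)"
      using le by eventually_elim (simp add: powr_mono2)
  qed
  with f False show ?thesis by (simp add: Lp_finite_iff)
qed

text \<open>
  A substitute for Minkowski's inequality: closure of \<open>L\<^sup>p\<close> under sums and operator bounds with an
  unspecified constant only need some constant here.
\<close>

lemma powr_abs_add_le:
  fixes a b r :: real
  assumes "0 \<le> r"
  shows "\<bar>a + b\<bar> powr r \<le> 2 powr r * (\<bar>a\<bar> powr r + \<bar>b\<bar> powr r)"
proof -
  have "\<bar>a + b\<bar> powr r \<le> (2 * max \<bar>a\<bar> \<bar>b\<bar>) powr r"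
    using assms by (intro powr_mono2) auto
  also have "\<dots> = 2 powr r * max \<bar>a\<bar> \<bar>b\<bar> powr r"
    by (simp add: powr_mult)
  also have "\<dots> \<le> 2 powr r * (\<bar>a\<bar> powr r + \<bar>b\<bar> powr r)"
    by (intro mult_left_mono) (auto simp: max_def)
  finally show ?thesis .
qed

lemma Lp_add:
  assumes f: "f \<in> Lp M p" and g: "g \<in> Lp M p"
  shows "(\<lambda>x. f x + g x) \<in> Lp M p"
proof -
  note [measurable] = Lp_measurable[OF f] Lp_measurable[OF g]
  show ?thesis
  proof (cases "p = \<infinity>")
    case True
    with f g obtain C D where "0 \<le> C" "AE x in M. \<bar>f x\<bar> \<le> C" "0 \<le> D" "AE x in M. \<bar>g x\<bar> \<le> D"
      by (auto simp: Lp_top_iff simp del: infinity_ennreal_def)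
    moreover from this(2,4) have "AE x in M. \<bar>f x + g x\<bar> \<le> C + D"
      by eventually_elim simp
    ultimately show ?thesis
      using True by (auto simp: Lp_top_iff simp del: infinity_ennreal_def intro!: exI[of _ "C + D"])
  next
    case False
    have "integrable M (\<lambda>x. \<bar>f x + g x\<bar> powr enn2real p)"
    proof (rule Bochner_Integration.integrable_bound)
      show "integrable M (\<lambda>x. 2 powr enn2real p * (\<bar>f x\<bar> powr enn2real p + \<bar>g x\<bar> powr enn2real p))"
        using f g False by (auto simp: Lp_finite_iff)
      show "(\<lambda>x. \<bar>f x + g x\<bar> powr enn2real p) \<in> borel_measurable M"
        by measurable
    qed (use powr_abs_add_le[of "enn2real p"] in auto)
    with False show ?thesis by (simp add: Lp_finite_iff)
  qed
qed

lemma Lp_cmult: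
  assumes f: "f \<in> Lp M p"
  shows "(\<lambda>x. c * f x) \<in> Lp M p"
proof -
  note [measurable] = Lp_measurable[OF f]
  show ?thesis
  proof (cases "p = \<infinity>")
    case True
    with f obtain C where "0 \<le> C" "AE x in M. \<bar>f x\<bar> \<le> C"
      by (auto simp: Lp_top_iff simp del: infinity_ennreal_def)
    moreover from this(2) have "AE x in M. \<bar>c * f x\<bar> \<le> \<bar>c\<bar> * C"
      by eventually_elim (simp add: abs_mult mult_left_mono)
    ultimately show ?thesis
      using True by (auto simp: Lp_top_iff simp del: infinity_ennreal_def intro!: exI[of _ "\<bar>c\<bar> * C"])
  next
    case False
    with f show ?thesis by (simp add: Lp_finite_iff abs_mult powr_mult)
  qed
qed

lemma Lp_diff_cmult:
  assumes "f \<in> Lp M p" "g \<in> Lp M p"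
  shows "(\<lambda>x. f x - c * g x) \<in> Lp M p"
  using Lp_add[OF assms(1) Lp_cmult[OF assms(2), of "-c"]] by simp

text \<open>
  Passing from extended nonnegative reals to reals separates the endpoint \<open>(1, \<infinity>)\<close> from the
  exponents to which the real version of Young's product inequality applies.
\<close>

lemma conjugate_exponent_cases:
  fixes p p' :: ennreal
  assumes "1 \<le> p" "p < \<infinity>" "1 / p + 1 / p' = 1"
  obtains "p = 1" "p' = \<infinity>"
  | "p' < \<infinity>" "1 < enn2real p" "1 < enn2real p'" "1 / enn2real p + 1 / enn2real p' = 1"
proof -
  obtain r where r: "p = ennreal r" "1 \<le> r"
    using assms by (cases p) auto
  show ?thesis
  proof (cases "p' = \<infinity>")
    case True
    then have "1 / p = 1"
      using assms by (simp add: divide_ennreal_def)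
    moreover have "1 / p = ennreal (1 / r)"
      using r divide_ennreal[of 1 r] by simp
    ultimately have "ennreal (1 / r) = 1"
      by simp
    then have "r = 1"
      by simp
    then show ?thesis
      using that(1) True r by simp
  next
    case False
    obtain s where s: "p' = ennreal s" "0 \<le> s"
      using False by (cases p') auto
    have "s \<noteq> 0"
      using assms(3) s by (auto simp: divide_ennreal_def)
    with s have "0 < s" by simp
    have "1 / p = ennreal (1 / r)" "1 / p' = ennreal (1 / s)"
      using r s \<open>0 < s\<close> divide_ennreal[of 1 r] divide_ennreal[of 1 s] by simp_all
    then have "ennreal (1 / r + 1 / s) = 1"
      using assms(3) r s by simp
    then have rs: "1 / r + 1 / s = 1"
      by (simp del: ennreal_plus)
    then have "1 / r < 1" "1 / s < 1"
      using r \<open>0 < s\<close> by (smt (verit) divide_pos_pos)+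
    then have "1 < r" "1 < s"
      using r \<open>0 < s\<close> by (auto simp: field_simps)
    then show ?thesis
      using that(2) r s rs by simp
  qed
qed

lemma conjugate_exponent_ge_1:
  fixes p p' :: ennreal
  assumes "1 \<le> p" "p < \<infinity>" "1 / p + 1 / p' = 1"
  shows "1 \<le> p'"
  using assms
proof (cases rule: conjugate_exponent_cases)
  case 2
  then show ?thesis by (cases p') auto
qed simp

text \<open>
  Integrability, rather than Hoelder's sharp bound, is all that the pairing requires, so the
  pointwise inequality \<open>a b \<le> a\<^sup>p / p + b\<^sup>q / q\<close> is enough away from the endpoint.
\<close>

lemma Lp_pairing_integrable:
  assumes p: "1 \<le> p" "p < \<infinity>" "1 / p + 1 / p' = 1"
    and f: "f \<in> Lp M p" and g: "g \<in> Lp M p'"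
  shows "integrable M (\<lambda>x. f x * g x)"
  using p
proof (cases rule: conjugate_exponent_cases)
  note [measurable] = Lp_measurable[OF f] Lp_measurable[OF g]
  case 1
  then have "integrable M f"
    using f by (simp add: Lp_finite_iff integrable_abs_iff)
  from 1 g obtain C where "0 \<le> C" and C: "AE x in M. \<bar>g x\<bar> \<le> C"
    by (auto simp: Lp_top_iff simp del: infinity_ennreal_def)
  show ?thesis
  proof (rule Bochner_Integration.integrable_bound)
    show "integrable M (\<lambda>x. C * f x)"
      using \<open>integrable M f\<close> by simp
    show "AE x in M. norm (f x * g x) \<le> norm (C * f x)"
      using C by eventually_elim (use \<open>0 \<le> C\<close> in \<open>simp add: abs_mult mult_left_mono mult.commute[of C]\<close>)
  qed measurable
next
  note [measurable] = Lp_measurable[OF f] Lp_measurable[OF g]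
  case 2
  let ?p = "enn2real p" and ?q = "enn2real p'"
  show ?thesis
  proof (rule Bochner_Integration.integrable_bound)
    show "integrable M (\<lambda>x. \<bar>f x\<bar> powr ?p / ?p + \<bar>g x\<bar> powr ?q / ?q)"
      using f g 2 p by (auto simp: Lp_finite_iff)
    show "AE x in M. norm (f x * g x) \<le> norm (\<bar>f x\<bar> powr ?p / ?p + \<bar>g x\<bar> powr ?q / ?q)"
    proof (rule AE_I2)
      fix x
      show "norm (f x * g x) \<le> norm (\<bar>f x\<bar> powr ?p / ?p + \<bar>g x\<bar> powr ?q / ?q)"
        using Youngs_inequality[of ?p ?q "\<bar>f x\<bar>" "\<bar>g x\<bar>"] 2 by (simp add: abs_mult)
    qed
  qed measurable
qed

section \<open>Jensen's inequality for powers\<close>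

text \<open>
  The convex function \<open>s \<mapsto> s\<^sup>q\<close> lies above its tangent at \<open>t\<close>.  This is Young's product inequality
  for \<open>s\<close> and \<open>t powr (q - 1)\<close>; the boundary value \<open>s = 0\<close> must be included, since
  the functions to which the inequality is applied may vanish.
\<close>

lemma powr_above_tangent:
  fixes s t q :: real
  assumes "1 \<le> q" "0 \<le> s" "0 \<le> t"
  shows "q * t powr (q - 1) * s - (q - 1) * t powr q \<le> s powr q"
proof (cases "q = 1 \<or> t = 0")
  case True
  then show ?thesis using assms by auto
next
  case False
  then have "1 < q" "0 < t" using assms by auto
  have "s * t powr (q - 1) \<le> s powr q / q + (t powr (q - 1)) powr (q / (q - 1)) / (q / (q - 1))"
    using \<open>1 < q\<close> assms by (intro Youngs_inequality) (auto simp: field_simps)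
  also have "(t powr (q - 1)) powr (q / (q - 1)) = t powr q"
    using \<open>1 < q\<close> by (simp add: powr_powr)
  finally have "q * (s * t powr (q - 1)) \<le> q * (s powr q / q + t powr q / (q / (q - 1)))"
    using \<open>1 < q\<close> by (intro mult_left_mono) auto
  also have "\<dots> = s powr q + (q - 1) * t powr q"
    using \<open>1 < q\<close> by (simp add: field_simps)
  finally show ?thesis
    by (simp add: algebra_simps)
qed

text \<open>
  Jensen's inequality for the measure with density \<open>\<bar>k\<bar>\<close>, which is finite but not normalised; the
  factor with exponent \<open>q - 1\<close> accounts for its total mass.  Integrate the tangent inequality at
  the \<open>\<bar>k\<bar>\<close>-average of \<open>\<bar>f\<bar>\<close>.
\<close>

lemma weighted_Jensen_powr:
  fixes k f :: "'a \<Rightarrow> real"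
  assumes q: "1 \<le> q" and k: "integrable M k" and [measurable]: "f \<in> borel_measurable M"
    and kfq: "integrable M (\<lambda>x. \<bar>k x\<bar> * \<bar>f x\<bar> powr q)"
  shows weighted_Jensen_integrable: "integrable M (\<lambda>x. k x * f x)"
    and weighted_Jensen_le: "\<bar>LINT x|M. k x * f x\<bar> powr q
      \<le> (LINT x|M. \<bar>k x\<bar>) powr (q - 1) * (LINT x|M. \<bar>k x\<bar> * \<bar>f x\<bar> powr q)"
proof -
  have [measurable]: "k \<in> borel_measurable M" using k by simp
  have le: "\<bar>y\<bar> \<le> 1 + \<bar>y\<bar> powr q" for y :: real
    using powr_mono[of 1 q "\<bar>y\<bar>"] q by (cases "\<bar>y\<bar> \<le> 1") (auto intro: add_increasing2)
  show kf: "integrable M (\<lambda>x. k x * f x)"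
  proof (rule Bochner_Integration.integrable_bound)
    show "integrable M (\<lambda>x. \<bar>k x\<bar> + \<bar>k x\<bar> * \<bar>f x\<bar> powr q)"
      using k kfq by auto
    have "\<bar>k x\<bar> * \<bar>f x\<bar> \<le> \<bar>k x\<bar> * (1 + \<bar>f x\<bar> powr q)" for x
      by (intro mult_left_mono le) auto
    then show "AE x in M. norm (k x * f x) \<le> norm (\<bar>k x\<bar> + \<bar>k x\<bar> * \<bar>f x\<bar> powr q)"
      by (simp add: abs_mult distrib_left)
  qed measurable
  define N where "N = (LINT x|M. \<bar>k x\<bar>)"
  define I where "I = (LINT x|M. \<bar>k x\<bar> * \<bar>f x\<bar>)"
  define J where "J = (LINT x|M. \<bar>k x\<bar> * \<bar>f x\<bar> powr q)"
  have kfa: "integrable M (\<lambda>x. \<bar>k x\<bar> * \<bar>f x\<bar>)"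
    using integrable_abs[OF kf] by (simp add: abs_mult)
  have "0 \<le> N" "0 \<le> I" unfolding N_def I_def by auto
  have absI: "\<bar>LINT x|M. k x * f x\<bar> \<le> I"
    using integral_abs_bound[of M "\<lambda>x. k x * f x"] by (simp add: I_def abs_mult)
  have "I powr q \<le> N powr (q - 1) * J"
  proof (cases "N = 0")
    case True
    then have "AE x in M. \<bar>k x\<bar> = 0"
      unfolding N_def using k by (subst (asm) integral_nonneg_eq_0_iff_AE) auto
    then have "AE x in M. \<bar>k x\<bar> * \<bar>f x\<bar> = 0"
      by eventually_elim simp
    then have "I = 0"
      unfolding I_def by (rule integral_eq_zero_AE)
    then show ?thesis using True by simp
  next
    case False
    with \<open>0 \<le> N\<close> have "0 < N" by simp
    \<comment> \<open>The average of \<open>\<bar>f\<bar>\<close>: at this point the linear term of the tangent integrates to zero.\<close>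
    define t where "t = I / N"
    have t: "0 \<le> t" "I = t * N" using \<open>0 < N\<close> \<open>0 \<le> I\<close> by (auto simp: t_def)
    have "t powr q * N = q * t powr (q - 1) * I - (q - 1) * t powr q * N"
    proof (cases "t = 0")
      case False
      then have "t powr (q - 1) * t = t powr q"
        using t by (simp add: powr_mult_base mult.commute)
      then show ?thesis
        unfolding t(2) by (simp add: algebra_simps)
    qed (use t in auto)
    also have "\<dots> = (LINT x|M. q * t powr (q - 1) * (\<bar>k x\<bar> * \<bar>f x\<bar>) - (q - 1) * t powr q * \<bar>k x\<bar>)"
      using kfa k by (simp add: I_def N_def)
    also have "\<dots> \<le> J"
      unfolding J_def
    proof (intro integral_mono kfq)
      fix x
      show "q * t powr (q - 1) * (\<bar>k x\<bar> * \<bar>f x\<bar>) - (q - 1) * t powr q * \<bar>k x\<bar> \<le> \<bar>k x\<bar> * \<bar>f x\<bar> powr q"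
        using mult_left_mono[OF powr_above_tangent[OF q _ t(1), of "\<bar>f x\<bar>"], of "\<bar>k x\<bar>"]
        by (simp add: algebra_simps)
    qed (use kfa k in auto)
    finally have *: "t powr q * N \<le> J" .
    have "I powr q = t powr q * N powr q"
      using t \<open>0 < N\<close> by (simp add: powr_mult)
    also have "N powr q = N powr (q - 1) * N"
      using \<open>0 < N\<close> by (simp add: powr_mult_base mult.commute)
    finally show ?thesis
      using mult_left_mono[OF *, of "N powr (q - 1)"] by (simp add: algebra_simps)
  qed
  moreover have "\<bar>LINT x|M. k x * f x\<bar> powr q \<le> I powr q"
    using absI q by (intro powr_mono2) auto
  ultimately show "\<bar>LINT x|M. k x * f x\<bar> powr q
      \<le> (LINT x|M. \<bar>k x\<bar>) powr (q - 1) * (LINT x|M. \<bar>k x\<bar> * \<bar>f x\<bar> powr q)"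
    by (simp add: N_def J_def)
qed

section \<open>Reflections and translations of Lebesgue measure\<close>

lemma
  fixes x :: "'a::euclidean_space"
  shows measurable_lebesgue_reflect [measurable]: "(\<lambda>y. x - y) \<in> lebesgue \<rightarrow>\<^sub>M lebesgue"
    and distr_lebesgue_reflect: "distr lebesgue lebesgue (\<lambda>y. x - y) = lebesgue"
proof -
  have T: "(\<lambda>y. x + (\<Sum>j\<in>Basis. (- 1 * (y \<bullet> j)) *\<^sub>R j)) = (\<lambda>y::'a. x - y)"
  proof
    fix y :: 'a
    have "(\<Sum>j\<in>Basis. (- 1 * (y \<bullet> j)) *\<^sub>R j) = - (\<Sum>j\<in>Basis. (y \<bullet> j) *\<^sub>R j)"
      by (simp add: sum_negf)
    then show "x + (\<Sum>j\<in>Basis. (- 1 * (y \<bullet> j)) *\<^sub>R j) = x - y"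
      by (simp add: euclidean_representation)
  qed
  show "(\<lambda>y. x - y) \<in> lebesgue \<rightarrow>\<^sub>M lebesgue"
    using lebesgue_affine_measurable[of "\<lambda>_. - 1" x] unfolding T by simp
  show "distr lebesgue lebesgue (\<lambda>y. x - y) = lebesgue"
    using lebesgue_affine_euclidean[of "\<lambda>_. - 1" x] unfolding T by (simp add: density_1)
qed

lemma AE_lebesgue_reflect:
  fixes x :: "'a::euclidean_space"
  assumes "AE y in lebesgue. P y"
  shows "AE y in lebesgue. P (x - y)"
proof -
  have "AE y in distr lebesgue lebesgue (\<lambda>y. x - y). P y"
    using assms by (simp only: distr_lebesgue_reflect)
  then show ?thesis
    by (rule AE_distrD[OF measurable_lebesgue_reflect])
qed

lemma integrable_lebesgue_reflect:
  fixes x :: "'a::euclidean_space" and f :: "'a \<Rightarrow> real"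
  assumes "integrable lebesgue f"
  shows "integrable lebesgue (\<lambda>y. f (x - y))"
  using assms integrable_distr[OF measurable_lebesgue_reflect, of x f]
  by (simp add: distr_lebesgue_reflect)

lemma integral_lebesgue_reflect:
  fixes x :: "'a::euclidean_space" and f :: "'a \<Rightarrow> real"
  assumes "f \<in> borel_measurable lebesgue"
  shows "(LINT y|lebesgue. f (x - y)) = (LINT y|lebesgue. f y)"
  using assms integral_distr[OF measurable_lebesgue_reflect, of f x]
  by (simp add: distr_lebesgue_reflect)

lemma integral_lborel_translate:
  fixes y :: "'a::euclidean_space" and f :: "'a \<Rightarrow> real"
  assumes [measurable]: "f \<in> borel_measurable borel"
  shows "(LINT x|lborel. f (x - y)) = (LINT x|lborel. f x)"
  using integral_distr[of "(+) (- y)" lborel borel f]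
  by (simp add: lborel_distr_plus)

lemma integrable_lborel_translate:
  fixes y :: "'a::euclidean_space" and f :: "'a \<Rightarrow> real"
  assumes "integrable lborel f"
  shows "integrable lborel (\<lambda>x. f (x - y))"
  using assms integrable_distr[of "(+) (- y)" lborel borel f]
  by (simp add: lborel_distr_plus)

section \<open>Convolution with an integrable kernel\<close>

definition convolution :: "('a::euclidean_space \<Rightarrow> real) \<Rightarrow> ('a \<Rightarrow> real) \<Rightarrow> 'a \<Rightarrow> real" where
  "convolution k f x = (LINT y|lebesgue. k (x - y) * f y)"

text \<open>
  The equality of the convolutions holds at every point \<open>x\<close>, not merely almost everywhere, because
  \<open>y \<mapsto> x - y\<close> preserves null sets.  Hence both factors may be replaced by Borel representatives
  without altering the convolution at all.
\<close>

lemma convolution_cong_AE: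
  assumes [measurable]: "k \<in> borel_measurable lebesgue" "k' \<in> borel_measurable lebesgue"
      "f \<in> borel_measurable lebesgue" "f' \<in> borel_measurable lebesgue"
    and "AE x in lebesgue. k x = k' x" and "AE x in lebesgue. f x = f' x"
  shows convolution_integrand_cong_AE:
      "integrable lebesgue (\<lambda>y. k (x - y) * f y) = integrable lebesgue (\<lambda>y. k' (x - y) * f' y)"
    and "convolution k f x = convolution k' f' x"
proof -
  have AE: "AE y in lebesgue. k (x - y) * f y = k' (x - y) * f' y"
    using AE_lebesgue_reflect[OF assms(5), of x] assms(6) by eventually_elim simp
  show "integrable lebesgue (\<lambda>y. k (x - y) * f y) = integrable lebesgue (\<lambda>y. k' (x - y) * f' y)"
    by (rule integrable_cong_AE[OF _ _ AE]) measurable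
  show "convolution k f x = convolution k' f' x"
    unfolding convolution_def by (rule integral_cong_AE[OF _ _ AE]) measurable
qed

text \<open>
  Lebesgue measurability of \<open>f\<close> does not make \<open>(x, y) \<mapsto> f (x - y)\<close> measurable for the product of the
  completed \<open>\<sigma>\<close>-algebras; Fubini's theorem is therefore applied to Borel representatives and the
  uncompleted measure.
\<close>

lemma borel_representative:
  fixes f :: "'a::euclidean_space \<Rightarrow> real"
  assumes "f \<in> borel_measurable lebesgue"
  obtains g where "g \<in> borel_measurable borel" "g \<in> borel_measurable lebesgue" "AE x in lebesgue. f x = g x"
proof -
  obtain g where g: "g \<in> borel_measurable lborel" "AE x in lborel. f x = g x"
    using completion_ex_borel_measurable_real[OF assms] by blast
  have "g \<in> borel_measurable borel"
    using g(1) by simp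
  then show ?thesis
    using measurable_completion[OF g(1)] AE_completion[OF g(2)] by (rule that)
qed

lemma convolution_measurable [measurable]:
  assumes k: "k \<in> borel_measurable lebesgue" and f: "f \<in> borel_measurable lebesgue"
  shows "convolution k f \<in> borel_measurable lebesgue"
proof -
  obtain k' where k': "k' \<in> borel_measurable borel" "k' \<in> borel_measurable lebesgue"
      "AE x in lebesgue. k x = k' x"
    using borel_representative[OF k] .
  obtain f' where f': "f' \<in> borel_measurable borel" "f' \<in> borel_measurable lebesgue"
      "AE x in lebesgue. f x = f' x"
    using borel_representative[OF f] .
  note [measurable] = k'(1) f'(1)
  have "convolution k f = (\<lambda>x. LINT y|lebesgue. k' (x - y) * f' y)"
    using convolution_cong_AE(2)[OF k k'(2) f f'(2) k'(3) f'(3)] by (auto simp: convolution_def)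
  also have "\<dots> = (\<lambda>x. LINT y|lborel. k' (x - y) * f' y)"
    by (intro ext integral_completion) measurable
  also have "\<dots> \<in> borel_measurable borel"
    by measurable
  finally have "convolution k f \<in> borel_measurable lborel"
    by simp
  then show ?thesis
    by (rule measurable_completion)
qed

text \<open>
  The case \<open>p = 1\<close> of Young's inequality: integrating \<open>k(x - y) f(y)\<close> first over \<open>x\<close> gives the
  integral of \<open>k\<close> times \<open>f(y)\<close>, by translation invariance.
\<close>

lemma
  assumes k: "integrable lebesgue k" and f: "integrable lebesgue f"
  shows convolution_L1_AE: "AE x in lebesgue. integrable lebesgue (\<lambda>y. k (x - y) * f y)"
    and convolution_L1_integrable: "integrable lebesgue (convolution k f)"
    and convolution_L1_integral:
      "(LINT x|lebesgue. convolution k f x) = (LINT x|lebesgue. k x) * (LINT x|lebesgue. f x)"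
proof -
  have km: "k \<in> borel_measurable lebesgue" and fm: "f \<in> borel_measurable lebesgue"
    using k f by auto
  obtain k' where k': "k' \<in> borel_measurable borel" "k' \<in> borel_measurable lebesgue"
      "AE x in lebesgue. k x = k' x"
    using borel_representative[OF km] .
  obtain f' where f': "f' \<in> borel_measurable borel" "f' \<in> borel_measurable lebesgue"
      "AE x in lebesgue. f x = f' x"
    using borel_representative[OF fm] .
  note [measurable] = k'(1) f'(1)
  have k'i: "integrable lborel k'" and f'i: "integrable lborel f'"
    using k f integrable_cong_AE[OF km k'(2,3)] integrable_cong_AE[OF fm f'(2,3)]
    by (auto simp: integrable_completion)
  have ints: "(LINT x|lebesgue. k x) = (LINT x|lborel. k' x)" "(LINT x|lebesgue. f x) = (LINT x|lborel. f' x)"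
    using integral_cong_AE[OF km k'(2,3)] integral_cong_AE[OF fm f'(2,3)]
    by (auto simp: integral_completion)
  let ?F = "\<lambda>y x. k' (x - y) * f' y"
  have F: "integrable (lborel \<Otimes>\<^sub>M lborel) (\<lambda>(y, x). ?F y x)"
  proof (rule lborel_pair.Fubini_integrable)
    have "(LINT x|lborel. \<bar>k' (x - y)\<bar>) = (LINT x|lborel. \<bar>k' x\<bar>)" for y
      using integral_lborel_translate[of "\<lambda>x. \<bar>k' x\<bar>" y] by simp
    then show "integrable lborel (\<lambda>y. LINT x|lborel. norm (case (y, x) of (y, x) \<Rightarrow> ?F y x))"
      using f'i by (simp add: abs_mult)
    show "AE y in lborel. integrable lborel (\<lambda>x. case (y, x) of (y, x) \<Rightarrow> ?F y x)"
      using integrable_lborel_translate[OF k'i] by simp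
  qed measurable
  have conv: "convolution k f x = (LINT y|lborel. ?F y x)" for x
    using convolution_cong_AE(2)[OF km k'(2) fm f'(2) k'(3) f'(3), of x]
    by (simp add: convolution_def integral_completion)
  have conv_int: "integrable lebesgue (\<lambda>y. k (x - y) * f y) = integrable lborel (\<lambda>y. ?F y x)" for x
    using convolution_cong_AE(1)[OF km k'(2) fm f'(2) k'(3) f'(3), of x]
    by (simp add: integrable_completion)
  have conv_b: "(\<lambda>x. LINT y|lborel. ?F y x) \<in> borel_measurable lborel"
    by measurable
  show "AE x in lebesgue. integrable lebesgue (\<lambda>y. k (x - y) * f y)"
    unfolding conv_int using lborel_pair.AE_integrable_snd[OF F] by (rule AE_completion)
  show "integrable lebesgue (convolution k f)"
    unfolding conv using lborel_pair.integrable_snd[OF F] conv_b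
    by (simp add: integrable_completion conv[abs_def])
  have "(LINT x|lebesgue. convolution k f x) = (LINT x|lborel. LINT y|lborel. ?F y x)"
    unfolding conv using conv_b by (rule integral_completion)
  also have "\<dots> = (LINT y|lborel. LINT x|lborel. ?F y x)"
    using lborel_pair.Fubini_integral[OF F] .
  also have "\<dots> = (LINT y|lborel. (LINT x|lborel. k' x) * f' y)"
    by (simp add: integral_lborel_translate)
  finally show "(LINT x|lebesgue. convolution k f x) = (LINT x|lebesgue. k x) * (LINT x|lebesgue. f x)"
    by (simp add: ints)
qed

text \<open>
  The two sides are the iterated integrals of \<open>k(x - y) u(y) v(x)\<close> in the two orders.  The two
  hypotheses on integrability make this function integrable on the product.
\<close>

lemma convolution_duality:
  assumes k: "k \<in> borel_measurable lebesgue" and u: "u \<in> borel_measurable lebesgue"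
    and v: "v \<in> borel_measurable lebesgue"
    and ae: "AE x in lebesgue. integrable lebesgue (\<lambda>y. k (x - y) * u y)"
    and int: "integrable lebesgue (\<lambda>x. convolution (\<lambda>z. \<bar>k z\<bar>) (\<lambda>y. \<bar>u y\<bar>) x * v x)"
  shows "(LINT x|lebesgue. convolution k u x * v x) = (LINT x|lebesgue. u x * convolution (\<lambda>z. k (- z)) v x)"
proof -
  obtain k' where k': "k' \<in> borel_measurable borel" "k' \<in> borel_measurable lebesgue"
      "AE x in lebesgue. k x = k' x"
    using borel_representative[OF k] .
  obtain u' where u': "u' \<in> borel_measurable borel" "u' \<in> borel_measurable lebesgue"
      "AE x in lebesgue. u x = u' x"
    using borel_representative[OF u] .
  obtain v' where v': "v' \<in> borel_measurable borel" "v' \<in> borel_measurable lebesgue"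
      "AE x in lebesgue. v x = v' x"
    using borel_representative[OF v] .
  note [measurable] = k'(1) u'(1) v'(1)
  let ?k = "\<lambda>z. k (- z)" and ?k' = "\<lambda>z. k' (- z)"
  have rk: "?k \<in> borel_measurable lebesgue" "?k' \<in> borel_measurable lebesgue"
      "AE x in lebesgue. ?k x = ?k' x"
    using measurable_compose[OF measurable_lebesgue_reflect[of 0] k]
      measurable_compose[OF measurable_lebesgue_reflect[of 0] k'(2)]
      AE_lebesgue_reflect[OF k'(3), of 0] by auto
  let ?F = "\<lambda>x y. k' (x - y) * u' y * v' x"
  have 1: "convolution k u x * v' x = (LINT y|lborel. ?F x y)" for x
    using convolution_cong_AE(2)[OF k k'(2) u u'(2) k'(3) u'(3), of x]
    by (simp add: convolution_def integral_completion)
  have 2: "u' y * convolution ?k v y = (LINT x|lborel. ?F x y)" for y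
    using convolution_cong_AE(2)[OF rk(1,2) v v'(2) rk(3) v'(3), of y]
    by (simp add: convolution_def integral_completion mult.commute mult.left_commute)
  have 3: "convolution (\<lambda>z. \<bar>k z\<bar>) (\<lambda>y. \<bar>u y\<bar>) x * \<bar>v' x\<bar> = (LINT y|lborel. \<bar>?F x y\<bar>)" for x
  proof -
    have "convolution (\<lambda>z. \<bar>k z\<bar>) (\<lambda>y. \<bar>u y\<bar>) x = convolution (\<lambda>z. \<bar>k' z\<bar>) (\<lambda>y. \<bar>u' y\<bar>) x"
      using k u k' u' by (intro convolution_cong_AE) auto
    then show ?thesis
      by (simp add: convolution_def integral_completion abs_mult)
  qed
  have F: "integrable (lborel \<Otimes>\<^sub>M lborel) (\<lambda>(x, y). ?F x y)"
  proof (rule lborel_pair.Fubini_integrable)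
    let ?g = "\<lambda>x. convolution (\<lambda>z. \<bar>k z\<bar>) (\<lambda>y. \<bar>u y\<bar>) x"
    have [measurable]: "?g \<in> borel_measurable lebesgue"
      using k u by (intro convolution_measurable) auto
    have "integrable lebesgue (\<lambda>x. \<bar>?g x * v x\<bar>)"
      using int by (rule integrable_abs)
    moreover have nn: "0 \<le> ?g x" for x
      by (simp add: convolution_def)
    ultimately have "integrable lebesgue (\<lambda>x. ?g x * \<bar>v x\<bar>)"
      by (simp add: abs_mult)
    moreover have "integrable lebesgue (\<lambda>x. ?g x * \<bar>v x\<bar>) = integrable lebesgue (\<lambda>x. ?g x * \<bar>v' x\<bar>)"
      using v v' by (intro integrable_cong_AE) auto
    ultimately show "integrable lborel (\<lambda>x. LINT y|lborel. norm (case (x, y) of (x, y) \<Rightarrow> ?F x y))"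
      by (simp add: 3 integrable_completion)
    have "AE x in lebesgue. integrable lborel (\<lambda>y. ?F x y)"
      using ae
    proof eventually_elim
      case (elim x)
      then have "integrable lborel (\<lambda>y. k' (x - y) * u' y)"
        using convolution_cong_AE(1)[OF k k'(2) u u'(2) k'(3) u'(3), of x]
        by (simp add: integrable_completion)
      then show ?case by simp
    qed
    then show "AE x in lborel. integrable lborel (\<lambda>y. case (x, y) of (x, y) \<Rightarrow> ?F x y)"
      by (simp add: AE_completion_iff)
  qed measurable
  have "(LINT x|lebesgue. convolution k u x * v x) = (LINT x|lebesgue. convolution k u x * v' x)"
    using v v' k u by (intro integral_cong_AE) auto
  also have "\<dots> = (LINT x|lborel. LINT y|lborel. ?F x y)"
    unfolding 1 by (rule integral_completion) measurable
  also have "\<dots> = (LINT y|lborel. LINT x|lborel. ?F x y)"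
    using lborel_pair.Fubini_integral[OF F] by simp
  also have "\<dots> = (LINT y|lebesgue. u' y * convolution ?k v y)"
    unfolding 2 by (rule integral_completion[symmetric]) measurable
  also have "\<dots> = (LINT y|lebesgue. u y * convolution ?k v y)"
    using u u' rk v by (intro integral_cong_AE) auto
  finally show ?thesis .
qed

text \<open>
  Young's inequality for a finite exponent.  Jensen's inequality with weight \<open>y \<mapsto> \<bar>k(x - y)\<bar>\<close> gives
  \<open>\<bar>k * f\<bar>\<^sup>q \<le> N\<^sup>q\<^sup>-\<^sup>1 (\<bar>k\<bar> * \<bar>f\<bar>\<^sup>q)\<close> wherever the right-hand convolution exists, \<open>N\<close> being the \<open>L\<^sup>1\<close>
  norm of \<open>k\<close>, and the case \<open>p = 1\<close> evaluates the integral of \<open>\<bar>k\<bar> * \<bar>f\<bar>\<^sup>q\<close>.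
\<close>

lemma
  assumes q: "1 \<le> q" and k: "integrable lebesgue k" and f: "f \<in> borel_measurable lebesgue"
    and fq: "integrable lebesgue (\<lambda>x. \<bar>f x\<bar> powr q)"
  shows Young_AE_integrable: "AE x in lebesgue. integrable lebesgue (\<lambda>y. k (x - y) * f y)"
    and Young_integrable: "integrable lebesgue (\<lambda>x. \<bar>convolution k f x\<bar> powr q)"
    and Young_le: "(LINT x|lebesgue. \<bar>convolution k f x\<bar> powr q)
      \<le> (LINT x|lebesgue. \<bar>k x\<bar>) powr q * (LINT x|lebesgue. \<bar>f x\<bar> powr q)"
proof -
  let ?N = "LINT x|lebesgue. \<bar>k x\<bar>"
  let ?g = "convolution (\<lambda>z. \<bar>k z\<bar>) (\<lambda>y. \<bar>f y\<bar> powr q)"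
  have ka: "integrable lebesgue (\<lambda>x. \<bar>k x\<bar>)" using k by simp
  have km [measurable]: "k \<in> borel_measurable lebesgue" using k by simp
  note [measurable] = f
  have g: "integrable lebesgue ?g"
    using ka fq by (rule convolution_L1_integrable)
  have pt: "AE x in lebesgue. integrable lebesgue (\<lambda>y. k (x - y) * f y) \<and>
      \<bar>convolution k f x\<bar> powr q \<le> ?N powr (q - 1) * ?g x"
    using convolution_L1_AE[OF ka fq]
  proof eventually_elim
    case (elim x)
    have "(LINT y|lebesgue. \<bar>k (x - y)\<bar>) = ?N"
      by (rule integral_lebesgue_reflect) simp
    then show ?case
      using weighted_Jensen_integrable[OF q integrable_lebesgue_reflect[OF k] f elim]
        weighted_Jensen_le[OF q integrable_lebesgue_reflect[OF k] f elim]
      by (simp add: convolution_def)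
  qed
  then show "AE x in lebesgue. integrable lebesgue (\<lambda>y. k (x - y) * f y)"
    by eventually_elim simp
  have gN: "integrable lebesgue (\<lambda>x. ?N powr (q - 1) * ?g x)"
    using g by simp
  show int: "integrable lebesgue (\<lambda>x. \<bar>convolution k f x\<bar> powr q)"
  proof (rule Bochner_Integration.integrable_bound[OF gN])
    show "AE x in lebesgue. norm (\<bar>convolution k f x\<bar> powr q) \<le> norm (?N powr (q - 1) * ?g x)"
      using pt by eventually_elim auto
    show "(\<lambda>x. \<bar>convolution k f x\<bar> powr q) \<in> borel_measurable lebesgue"
      using convolution_measurable[OF km f] by measurable
  qed
  have "(LINT x|lebesgue. \<bar>convolution k f x\<bar> powr q) \<le> (LINT x|lebesgue. ?N powr (q - 1) * ?g x)"
    by (rule integral_mono_AE[OF int gN]) (use pt in auto)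
  also have "\<dots> = (?N powr (q - 1) * ?N) * (LINT x|lebesgue. \<bar>f x\<bar> powr q)"
    by (simp add: convolution_L1_integral[OF ka fq])
  also have "?N powr (q - 1) * ?N = ?N powr q"
    by (cases "?N = 0") (auto simp: powr_mult_base mult.commute)
  finally show "(LINT x|lebesgue. \<bar>convolution k f x\<bar> powr q)
      \<le> (LINT x|lebesgue. \<bar>k x\<bar>) powr q * (LINT x|lebesgue. \<bar>f x\<bar> powr q)" .
qed

text \<open>
  For \<open>p = \<infinity>\<close> an essential bound \<open>C\<close> of \<open>f\<close> gives the dominating function \<open>C \<bar>k(x - y)\<bar>\<close> at every \<open>x\<close>.
\<close>

lemma
  assumes k: "integrable lebesgue k" and f: "f \<in> Lp lebesgue p" and p: "1 \<le> p"
  shows convolution_Lp_AE_integrable: "AE x in lebesgue. integrable lebesgue (\<lambda>y. k (x - y) * f y)" (is ?A)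
    and convolution_Lp: "convolution k f \<in> Lp lebesgue p" (is ?B)
proof -
  note fm = Lp_measurable[OF f]
  have km: "k \<in> borel_measurable lebesgue" using k by simp
  note [measurable] = fm km
  have "?A \<and> ?B"
  proof (cases "p = \<infinity>")
    case True
    with f obtain C where "0 \<le> C" and C: "AE x in lebesgue. \<bar>f x\<bar> \<le> C"
      by (auto simp: Lp_top_iff simp del: infinity_ennreal_def)
    have kC: "integrable lebesgue (\<lambda>y. C * \<bar>k (x - y)\<bar>)" for x
      using integrable_lebesgue_reflect[OF k, of x] by simp
    have le: "AE y in lebesgue. norm (k (x - y) * f y) \<le> C * \<bar>k (x - y)\<bar>" for x
      using C by eventually_elim (simp add: abs_mult mult_left_mono mult.commute[of C])
    have int: "integrable lebesgue (\<lambda>y. k (x - y) * f y)" for x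
    proof (rule Bochner_Integration.integrable_bound[OF kC])
      show "AE y in lebesgue. norm (k (x - y) * f y) \<le> norm (C * \<bar>k (x - y)\<bar>)"
        using le[of x] \<open>0 \<le> C\<close> by simp
    qed measurable
    have "\<bar>convolution k f x\<bar> \<le> C * (LINT y|lebesgue. \<bar>k y\<bar>)" for x
    proof -
      have "\<bar>convolution k f x\<bar> \<le> (LINT y|lebesgue. norm (k (x - y) * f y))"
        unfolding convolution_def by (metis integral_norm_bound real_norm_def)
      also have "\<dots> \<le> (LINT y|lebesgue. C * \<bar>k (x - y)\<bar>)"
        by (intro integral_mono_AE integrable_norm int kC le)
      also have "\<dots> = C * (LINT y|lebesgue. \<bar>k y\<bar>)"
        using integral_lebesgue_reflect[of "\<lambda>y. \<bar>k y\<bar>" x] by simp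
      finally show ?thesis .
    qed
    then show ?thesis
      using int True convolution_measurable[OF km fm] \<open>0 \<le> C\<close>
      by (auto simp: Lp_top_iff simp del: infinity_ennreal_def intro!: exI[of _ "C * (LINT y|lebesgue. \<bar>k y\<bar>)"])
  next
    case False
    then have "1 \<le> enn2real p"
      using p by (cases p) auto
    then show ?thesis
      using Young_AE_integrable[OF _ k fm] Young_integrable[OF _ k fm] f False
        convolution_measurable[OF km fm] by (simp add: Lp_finite_iff)
  qed
  then show ?A ?B by auto
qed

lemma convolution_add_AE:
  assumes k: "integrable lebesgue k" and p: "1 \<le> p" and f: "f \<in> Lp lebesgue p" and g: "g \<in> Lp lebesgue p"
  shows "AE x in lebesgue. convolution k (\<lambda>y. f y + g y) x = convolution k f x + convolution k g x"
  using convolution_Lp_AE_integrable[OF k f p] convolution_Lp_AE_integrable[OF k g p]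
  by eventually_elim (simp add: convolution_def distrib_left)

lemma convolution_cmult: "convolution k (\<lambda>y. c * f y) x = c * convolution k f x"
  by (simp add: convolution_def mult.left_commute)

section \<open>Restriction to a domain, extension by zero, and norm bounds\<close>

lemma borel_measurable_lebesgue_AE_cong:
  fixes f g :: "'a::euclidean_space \<Rightarrow> real"
  assumes "AE x in lebesgue. f x = g x" and [measurable]: "g \<in> borel_measurable lebesgue"
  shows "f \<in> borel_measurable lebesgue"
proof (rule measurableI)
  fix A :: "real set" assume [measurable]: "A \<in> sets borel"
  show "f -` A \<inter> space lebesgue \<in> sets lebesgue"
  proof (rule completion.in_sets_AE)
    show "AE x in lebesgue. (x \<in> g -` A \<inter> space lebesgue) = (x \<in> f -` A \<inter> space lebesgue)"
      using assms(1) by eventually_elim simp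
  qed (use measurable_sets[OF assms(2), of A] in simp_all)
qed simp

lemma Lp_lebesgue_on_iff:
  fixes f :: "'a::euclidean_space \<Rightarrow> real"
  assumes S: "S \<in> sets lebesgue"
  shows "f \<in> Lp (lebesgue_on S) p \<longleftrightarrow> (\<lambda>x. indicator S x * f x) \<in> Lp lebesgue p"
proof -
  have meas: "f \<in> borel_measurable (lebesgue_on S) \<longleftrightarrow> (\<lambda>x. indicator S x * f x) \<in> borel_measurable lebesgue"
    using S by (simp add: borel_measurable_restrict_space_iff)
  show ?thesis
  proof (cases "p = \<infinity>")
    case True
    have "(AE x in lebesgue_on S. \<bar>f x\<bar> \<le> C) \<longleftrightarrow> (AE x in lebesgue. \<bar>indicator S x * f x\<bar> \<le> C)" if "0 \<le> C" for C
      using S that by (auto simp: AE_restrict_space_iff indicator_def intro!: AE_cong)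
    with True meas show ?thesis
      by (auto simp: Lp_top_iff simp del: infinity_ennreal_def)
  next
    case False
    have "indicator S x *\<^sub>R \<bar>f x\<bar> powr enn2real p = \<bar>indicator S x * f x\<bar> powr enn2real p" for x
      by (simp add: indicator_def)
    then have "integrable (lebesgue_on S) (\<lambda>x. \<bar>f x\<bar> powr enn2real p)
        \<longleftrightarrow> integrable lebesgue (\<lambda>x. \<bar>indicator S x * f x\<bar> powr enn2real p)"
      using S by (simp add: integrable_restrict_space)
    with False meas show ?thesis by (simp add: Lp_finite_iff)
  qed
qed

lemma Lp_norm_lebesgue_on:
  fixes f :: "'a::euclidean_space \<Rightarrow> real"
  assumes S: "S \<in> sets lebesgue" and "p \<noteq> \<infinity>"
  shows "Lp_norm (lebesgue_on S) p f = Lp_norm lebesgue p (\<lambda>x. indicator S x * f x)"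
proof -
  have "indicator S x *\<^sub>R \<bar>f x\<bar> powr enn2real p = \<bar>indicator S x * f x\<bar> powr enn2real p" for x
    by (simp add: indicator_def)
  then show ?thesis
    using assms by (simp add: Lp_norm_def integral_restrict_space)
qed

lemma Lp_indicator:
  assumes f: "f \<in> Lp M p" and [measurable]: "A \<in> sets M"
  shows "(\<lambda>x. indicator A x * f x) \<in> Lp M p"
proof (rule Lp_dominated[OF f])
  show "(\<lambda>x. indicator A x * f x) \<in> borel_measurable M"
    using Lp_measurable[OF f] by measurable
qed (auto simp: indicator_def)

lemma Lp_norm_mono:
  assumes g: "g \<in> Lp M p" and f: "f \<in> borel_measurable M" and le: "AE x in M. \<bar>f x\<bar> \<le> \<bar>g x\<bar>"
    and p: "p \<noteq> \<infinity>"
  shows "Lp_norm M p f \<le> Lp_norm M p g"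
proof -
  have "(LINT x|M. \<bar>f x\<bar> powr enn2real p) \<le> (LINT x|M. \<bar>g x\<bar> powr enn2real p)"
  proof (rule integral_mono_AE)
    show "AE x in M. \<bar>f x\<bar> powr enn2real p \<le> \<bar>g x\<bar> powr enn2real p"
      using le by eventually_elim (simp add: powr_mono2)
  qed (use Lp_dominated[OF g f le] g p in \<open>auto simp: Lp_finite_iff\<close>)
  with p show ?thesis
    by (simp add: Lp_norm_def powr_mono2)
qed

text \<open>
  The form that the adjoint takes once its argument is cut off to \<open>\<Omega>\<close>.  The two terms are bounded by
  Young's inequality and by homogeneity.
\<close>

lemma convolution_minus_multiple_bounded:
  assumes k: "integrable lebesgue k" and p: "1 \<le> p" "p \<noteq> \<infinity>"
  shows "\<exists>C\<ge>0. \<forall>f\<in>Lp lebesgue p. Lp_norm lebesgue p (\<lambda>x. convolution k f x - c * f x) \<le> C * Lp_norm lebesgue p f"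
proof -
  let ?r = "enn2real p" and ?N = "LINT x|lebesgue. \<bar>k x\<bar>"
  have r: "1 \<le> ?r" using p by (cases p) auto
  let ?K = "2 powr ?r * (?N powr ?r + \<bar>c\<bar> powr ?r)"
  have "Lp_norm lebesgue p (\<lambda>x. convolution k f x - c * f x) \<le> ?K powr (1 / ?r) * Lp_norm lebesgue p f"
    if f: "f \<in> Lp lebesgue p" for f
  proof -
    have fm: "f \<in> borel_measurable lebesgue" and fr: "integrable lebesgue (\<lambda>x. \<bar>f x\<bar> powr ?r)"
      using f p by (auto simp: Lp_finite_iff)
    note cr = Young_integrable[OF r k fm fr]
    let ?J = "LINT x|lebesgue. \<bar>f x\<bar> powr ?r"
    have Tr: "integrable lebesgue (\<lambda>x. \<bar>convolution k f x - c * f x\<bar> powr ?r)"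
      using Lp_diff_cmult[OF convolution_Lp[OF k f p(1)] f, of c] p by (simp add: Lp_finite_iff)
    have "(LINT x|lebesgue. \<bar>convolution k f x - c * f x\<bar> powr ?r)
        \<le> (LINT x|lebesgue. 2 powr ?r * (\<bar>convolution k f x\<bar> powr ?r + \<bar>c\<bar> powr ?r * \<bar>f x\<bar> powr ?r))"
    proof (rule integral_mono[OF Tr])
      fix x
      show "\<bar>convolution k f x - c * f x\<bar> powr ?r
          \<le> 2 powr ?r * (\<bar>convolution k f x\<bar> powr ?r + \<bar>c\<bar> powr ?r * \<bar>f x\<bar> powr ?r)"
        using powr_abs_add_le[of ?r "convolution k f x" "- (c * f x)"] r by (simp add: abs_mult powr_mult)
    qed (use cr fr in auto)
    also have "\<dots> = 2 powr ?r * ((LINT x|lebesgue. \<bar>convolution k f x\<bar> powr ?r) + \<bar>c\<bar> powr ?r * ?J)"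
      using cr fr by simp
    also have "\<dots> \<le> 2 powr ?r * (?N powr ?r * ?J + \<bar>c\<bar> powr ?r * ?J)"
      using Young_le[OF r k fm fr] by (intro mult_left_mono add_right_mono) auto
    also have "\<dots> = ?K * ?J"
      by (simp add: algebra_simps)
    finally have "(LINT x|lebesgue. \<bar>convolution k f x - c * f x\<bar> powr ?r) powr (1 / ?r) \<le> (?K * ?J) powr (1 / ?r)"
      by (intro powr_mono2) (use r in auto)
    also have "\<dots> = ?K powr (1 / ?r) * ?J powr (1 / ?r)"
      by (intro powr_mult)
    finally show ?thesis
      using p by (simp add: Lp_norm_def)
  qed
  then show ?thesis
    by (intro exI[of _ "?K powr (1 / ?r)"]) auto
qed

section \<open>The nonlocal operators as convolutions\<close>

lemma cball_subset_ext_domain: "x \<in> \<Omega> \<Longrightarrow> cball x \<delta> \<subseteq> ext_domain \<delta> \<Omega>"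
  by (auto simp: ext_domain_def collar_def)

text \<open>
  The union of the balls centred in \<open>\<Omega>\<close> is a union of translates of \<open>\<Omega>\<close>, hence open although
  the balls are closed.  This is where the measurability of the extended domain comes from.
\<close>

lemma open_ext_domain:
  assumes "open \<Omega>" "0 < \<delta>"
  shows "open (ext_domain \<delta> \<Omega>)"
proof -
  have "ext_domain \<delta> \<Omega> = (\<Union>z\<in>cball 0 \<delta>. (\<lambda>x. z + x) ` \<Omega>)"
  proof (intro equalityI subsetI)
    fix y assume "y \<in> ext_domain \<delta> \<Omega>"
    then obtain x where "x \<in> \<Omega>" "y \<in> cball x \<delta>"
      using \<open>0 < \<delta>\<close> by (force simp: ext_domain_def collar_def)
    then show "y \<in> (\<Union>z\<in>cball 0 \<delta>. (\<lambda>x. z + x) ` \<Omega>)"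
      by (intro UN_I[of "y - x"] image_eqI[of _ _ x]) (auto simp: dist_norm norm_minus_commute)
  next
    fix y assume "y \<in> (\<Union>z\<in>cball 0 \<delta>. (\<lambda>x. z + x) ` \<Omega>)"
    then obtain z x where "y = z + x" "x \<in> \<Omega>" "norm z \<le> \<delta>"
      by auto
    then have "y \<in> cball x \<delta>" by (simp add: dist_norm)
    then show "y \<in> ext_domain \<delta> \<Omega>"
      using cball_subset_ext_domain[OF \<open>x \<in> \<Omega>\<close>] by blast
  qed
  also have "open \<dots>"
    using assms by (intro open_UN ballI open_translation)
  finally show ?thesis .
qed

text \<open>
  The operators integrate over open balls, so the cutoff is part of the kernel that is convolved.
\<close>

definition truncated_kernel :: "real \<Rightarrow> ('a \<Rightarrow> real) \<Rightarrow> 'a::euclidean_space \<Rightarrow> real" where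
  "truncated_kernel \<delta> \<mu> z = indicator (ball 0 \<delta>) z * \<mu> z"

lemma truncated_kernel_integrable:
  assumes "integrable lebesgue \<mu>"
  shows "integrable lebesgue (truncated_kernel \<delta> \<mu>)"
proof -
  have "integrable lebesgue (\<lambda>z. indicator (ball 0 \<delta>) z *\<^sub>R \<mu> z)"
    by (intro integrable_mult_indicator assms) simp
  then show ?thesis
    by (simp add: truncated_kernel_def[abs_def])
qed

lemma integral_truncated_kernel:
  "(LINT z|lebesgue_on (ball 0 \<delta>). \<mu> z) = (LINT z|lebesgue. truncated_kernel \<delta> \<mu> z)"
  by (simp add: integral_restrict_space truncated_kernel_def)

lemma indicator_ball_diff:
  fixes x y :: "'a::real_normed_vector"
  shows "indicator (ball 0 \<delta>) (x - y) = (indicator (ball x \<delta>) y :: real)"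
  by (simp add: indicator_def dist_norm norm_minus_commute)

lemma nl_adj_integrand_eq:
  "indicator (ext_domain \<delta> \<Omega>) y * nl_adj_integrand \<delta> \<mu> \<Omega> u x y
    = truncated_kernel \<delta> \<mu> (x - y) * (indicator \<Omega> y * u y)"
  by (simp add: nl_adj_integrand_def truncated_kernel_def indicator_ball_diff)
    (simp add: indicator_def ext_domain_def)

text \<open>
  In the term with \<open>v x\<close> the indicator of the extended domain has disappeared: for \<open>x\<close> in \<open>\<Omega>\<close> the
  kernel vanishes outside the ball around \<open>x\<close>, which is contained in the extended domain.
\<close>

lemma nl_deriv_integrand_eq:
  "indicator (ext_domain \<delta> \<Omega>) y * nl_deriv_integrand \<delta> \<mu> \<Omega> v x y
    = indicator \<Omega> x * (truncated_kernel \<delta> \<mu> (- (x - y)) * (indicator (ext_domain \<delta> \<Omega>) y * v y)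
        - v x * truncated_kernel \<delta> \<mu> (- (x - y)))"
proof (cases "x \<in> \<Omega> \<and> y \<in> ball x \<delta>")
  case True
  then have "y \<in> ext_domain \<delta> \<Omega>"
    using cball_subset_ext_domain[of x \<Omega> \<delta>] by auto
  with True show ?thesis
    by (simp add: nl_deriv_integrand_def truncated_kernel_def dist_norm norm_minus_commute algebra_simps)
next
  case False
  then show ?thesis
    by (auto simp: nl_deriv_integrand_def truncated_kernel_def dist_norm norm_minus_commute)
qed

locale nonlocal_setting =
  fixes \<Omega> :: "'a::euclidean_space set" and \<delta> :: real and \<mu> :: "'a \<Rightarrow> real"
  assumes open_\<Omega>: "open \<Omega>" and \<delta>_pos: "0 < \<delta>" and \<mu>_integrable: "integrable lebesgue \<mu>"
begin

abbreviation "S \<equiv> ext_domain \<delta> \<Omega>"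
abbreviation "k \<equiv> truncated_kernel \<delta> \<mu>"
abbreviation "k_refl \<equiv> (\<lambda>z. k (- z))"
abbreviation "mass \<equiv> LINT z|lebesgue. k z"

lemma S_sets [measurable]: "S \<in> sets lebesgue"
  using open_ext_domain[OF open_\<Omega> \<delta>_pos] by simp

lemma \<Omega>_sets [measurable]: "\<Omega> \<in> sets lebesgue"
  using open_\<Omega> by simp

lemma k_integrable: "integrable lebesgue k"
  by (rule truncated_kernel_integrable[OF \<mu>_integrable])

lemma k_refl_integrable: "integrable lebesgue k_refl"
  using integrable_lebesgue_reflect[OF k_integrable, of 0] by simp

lemma indicator_\<Omega>_S: "indicator \<Omega> x * (indicator S x :: real) = indicator \<Omega> x"
  by (simp add: indicator_def ext_domain_def)

lemma zero_extension_S: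
  "u \<in> Lp (lebesgue_on S) q \<Longrightarrow> (\<lambda>x. indicator S x * u x) \<in> Lp lebesgue q"
  by (simp add: Lp_lebesgue_on_iff)

lemma zero_extension_\<Omega>:
  assumes "u \<in> Lp (lebesgue_on S) q"
  shows "(\<lambda>x. indicator \<Omega> x * u x) \<in> Lp lebesgue q"
  using Lp_indicator[OF zero_extension_S[OF assms] \<Omega>_sets]
  by (simp add: mult.assoc[symmetric] indicator_\<Omega>_S)

lemma integrable_nl_adj_integrand_iff:
  "integrable (lebesgue_on S) (nl_adj_integrand \<delta> \<mu> \<Omega> u x)
    \<longleftrightarrow> integrable lebesgue (\<lambda>y. k (x - y) * (indicator \<Omega> y * u y))"
  by (simp add: integrable_restrict_space nl_adj_integrand_eq)

text \<open>
  This holds at every point, because no integral of a difference has to be split: where the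
  integrand is not integrable, the integral and the convolution share their default value \<open>0\<close>.
\<close>

lemma nl_adj_eq:
  "nl_adj \<delta> \<mu> \<Omega> u x = convolution k (\<lambda>y. indicator \<Omega> y * u y) x - mass * (indicator \<Omega> x * u x)"
  by (simp add: nl_adj_def integral_restrict_space nl_adj_integrand_eq convolution_def
      integral_truncated_kernel[symmetric])

lemma nl_adj_Lp:
  assumes q: "1 \<le> q" and u: "u \<in> Lp (lebesgue_on S) q"
  shows "nl_adj \<delta> \<mu> \<Omega> u \<in> Lp lebesgue q"
  unfolding nl_adj_eq[abs_def]
  by (intro Lp_diff_cmult convolution_Lp k_integrable zero_extension_\<Omega> u q)

text \<open>
  Here the integral of a difference is split, which is legitimate at the points where the convolution
  exists.  At the remaining points of \<open>\<Omega>\<close> the derivative takes a default value, so the formula is restricted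
  to almost every \<open>x\<close>.
\<close>

lemma nl_deriv_integrand_AE:
  assumes q: "1 \<le> q" and v: "v \<in> Lp (lebesgue_on S) q"
  shows nl_deriv_integrand_integrable_AE:
      "AE x in lebesgue. integrable (lebesgue_on S) (nl_deriv_integrand \<delta> \<mu> \<Omega> v x)"
    and nl_deriv_eq_AE: "AE x in lebesgue. nl_deriv \<delta> \<mu> \<Omega> v x
      = indicator \<Omega> x * (convolution k_refl (\<lambda>y. indicator S y * v y) x - mass * (indicator S x * v x))"
proof -
  let ?P = "\<lambda>x. integrable (lebesgue_on S) (nl_deriv_integrand \<delta> \<mu> \<Omega> v x) \<and> nl_deriv \<delta> \<mu> \<Omega> v x
      = indicator \<Omega> x * (convolution k_refl (\<lambda>y. indicator S y * v y) x - mass * (indicator S x * v x))"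
  have "AE x in lebesgue. ?P x"
    using convolution_Lp_AE_integrable[OF k_refl_integrable zero_extension_S[OF v] q]
  proof eventually_elim
    case (elim x)
    have kx: "integrable lebesgue (\<lambda>y. k (- (x - y)))"
      using integrable_lebesgue_reflect[OF k_refl_integrable, of x] .
    have cx: "(LINT y|lebesgue. k (- (x - y))) = mass"
      using integral_lebesgue_reflect[of k_refl x] integral_lebesgue_reflect[of k 0]
        borel_measurable_integrable[OF k_refl_integrable] borel_measurable_integrable[OF k_integrable]
      by simp
    have ix: "indicator \<Omega> x * (a - mass * (indicator S x * v x)) = indicator \<Omega> x * (a - v x * mass)" for a
      by (simp add: indicator_def ext_domain_def)
    show "?P x"
      unfolding ix using elim kx cx S_sets
      by (simp add: nl_deriv_def integrable_restrict_space integral_restrict_space nl_deriv_integrand_eq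
          convolution_def del: minus_diff_eq)
  qed
  then show "AE x in lebesgue. integrable (lebesgue_on S) (nl_deriv_integrand \<delta> \<mu> \<Omega> v x)"
    and "AE x in lebesgue. nl_deriv \<delta> \<mu> \<Omega> v x
      = indicator \<Omega> x * (convolution k_refl (\<lambda>y. indicator S y * v y) x - mass * (indicator S x * v x))"
    by (eventually_elim, simp)+
qed

text \<open>
  Completeness of Lebesgue measure transfers measurability from the convolution formula, which
  represents the derivative only almost everywhere.
\<close>

lemma nl_deriv_Lp:
  assumes q: "1 \<le> q" and v: "v \<in> Lp (lebesgue_on S) q"
  shows "nl_deriv \<delta> \<mu> \<Omega> v \<in> Lp lebesgue q"
proof -
  let ?g = "\<lambda>x. indicator \<Omega> x * (convolution k_refl (\<lambda>y. indicator S y * v y) x - mass * (indicator S x * v x))"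
  have g: "?g \<in> Lp lebesgue q"
    by (intro Lp_indicator Lp_diff_cmult convolution_Lp k_refl_integrable zero_extension_S v q \<Omega>_sets)
  show ?thesis
  proof (rule Lp_dominated[OF g])
    show "nl_deriv \<delta> \<mu> \<Omega> v \<in> borel_measurable lebesgue"
      using nl_deriv_eq_AE[OF q v] Lp_measurable[OF g] by (rule borel_measurable_lebesgue_AE_cong)
    show "AE x in lebesgue. \<bar>nl_deriv \<delta> \<mu> \<Omega> v x\<bar> \<le> \<bar>?g x\<bar>"
      using nl_deriv_eq_AE[OF q v] by eventually_elim simp
  qed
qed

lemma Lp_restrict: "f \<in> Lp lebesgue q \<Longrightarrow> f \<in> Lp (lebesgue_on S) q"
  by (simp add: Lp_lebesgue_on_iff Lp_indicator)

lemma AE_restrict: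
  assumes "AE x in lebesgue. P x"
  shows "AE x in lebesgue_on S. P x"
proof -
  have "AE x in lebesgue. x \<in> S \<longrightarrow> P x"
    using assms by eventually_elim simp
  then show ?thesis
    using S_sets by (simp add: AE_restrict_space_iff)
qed

lemma nl_deriv_operator:
  assumes q: "1 \<le> q"
  shows "operator_on_Lp (lebesgue_on S) q (nl_deriv \<delta> \<mu> \<Omega>)"
  unfolding operator_on_Lp_def
proof (intro conjI ballI impI)
  fix u v assume u: "u \<in> Lp (lebesgue_on S) q" and v: "v \<in> Lp (lebesgue_on S) q"
    and uv: "AE x in lebesgue_on S. u x = v x"
  have ae: "AE x in lebesgue. indicator S x * u x = indicator S x * v x"
    using uv S_sets by (auto simp: AE_restrict_space_iff indicator_def)
  have conv: "convolution k_refl (\<lambda>y. indicator S y * u y) x = convolution k_refl (\<lambda>y. indicator S y * v y) x" for x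
    by (rule convolution_cong_AE(2))
      (use ae k_refl_integrable zero_extension_S[OF u] zero_extension_S[OF v] in \<open>auto intro: Lp_measurable\<close>)
  have "AE x in lebesgue. nl_deriv \<delta> \<mu> \<Omega> u x = nl_deriv \<delta> \<mu> \<Omega> v x"
    using nl_deriv_eq_AE[OF q u] nl_deriv_eq_AE[OF q v] ae by eventually_elim (simp add: conv)
  then show "AE x in lebesgue_on S. nl_deriv \<delta> \<mu> \<Omega> u x = nl_deriv \<delta> \<mu> \<Omega> v x"
    by (rule AE_restrict)
qed (rule Lp_restrict[OF nl_deriv_Lp[OF q]])

lemma nl_adj_bounded_linear:
  assumes p: "1 \<le> p" "p \<noteq> \<infinity>"
  shows "bounded_linear_on_Lp (lebesgue_on S) p (nl_adj \<delta> \<mu> \<Omega>)"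
  unfolding bounded_linear_on_Lp_def operator_on_Lp_def
proof (intro conjI ballI impI allI)
  fix u assume u: "u \<in> Lp (lebesgue_on S) p"
  show "nl_adj \<delta> \<mu> \<Omega> u \<in> Lp (lebesgue_on S) p"
    by (intro Lp_restrict nl_adj_Lp p u)
  fix a
  have "nl_adj \<delta> \<mu> \<Omega> (\<lambda>y. a * u y) x = a * nl_adj \<delta> \<mu> \<Omega> u x" for x
    using convolution_cmult[of k a "\<lambda>y. indicator \<Omega> y * u y" x]
    by (simp add: nl_adj_eq mult.left_commute right_diff_distrib)
  then show "AE x in lebesgue_on S. nl_adj \<delta> \<mu> \<Omega> (\<lambda>y. a * u y) x = a * nl_adj \<delta> \<mu> \<Omega> u x"
    by simp
next
  fix u v assume u: "u \<in> Lp (lebesgue_on S) p" and v: "v \<in> Lp (lebesgue_on S) p"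
  have "AE x in lebesgue. nl_adj \<delta> \<mu> \<Omega> (\<lambda>y. u y + v y) x = nl_adj \<delta> \<mu> \<Omega> u x + nl_adj \<delta> \<mu> \<Omega> v x"
    using convolution_add_AE[OF k_integrable p(1) zero_extension_\<Omega>[OF u] zero_extension_\<Omega>[OF v]]
    by eventually_elim (simp add: nl_adj_eq algebra_simps)
  then show "AE x in lebesgue_on S. nl_adj \<delta> \<mu> \<Omega> (\<lambda>y. u y + v y) x = nl_adj \<delta> \<mu> \<Omega> u x + nl_adj \<delta> \<mu> \<Omega> v x"
    by (rule AE_restrict)
  assume uv: "AE x in lebesgue_on S. u x = v x"
  have ae: "AE x in lebesgue. indicator \<Omega> x * u x = indicator \<Omega> x * v x"
    using uv S_sets by (auto simp: AE_restrict_space_iff indicator_def ext_domain_def)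
  have conv: "convolution k (\<lambda>y. indicator \<Omega> y * u y) x = convolution k (\<lambda>y. indicator \<Omega> y * v y) x" for x
    by (rule convolution_cong_AE(2))
      (use ae k_integrable zero_extension_\<Omega>[OF u] zero_extension_\<Omega>[OF v] in \<open>auto intro: Lp_measurable\<close>)
  have "AE x in lebesgue. nl_adj \<delta> \<mu> \<Omega> u x = nl_adj \<delta> \<mu> \<Omega> v x"
    using ae by eventually_elim (simp add: nl_adj_eq conv)
  then show "AE x in lebesgue_on S. nl_adj \<delta> \<mu> \<Omega> u x = nl_adj \<delta> \<mu> \<Omega> v x"
    by (rule AE_restrict)
next
  obtain C where "0 \<le> C" and C: "\<And>f. f \<in> Lp lebesgue p \<Longrightarrow>
      Lp_norm lebesgue p (\<lambda>x. convolution k f x - mass * f x) \<le> C * Lp_norm lebesgue p f"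
    using convolution_minus_multiple_bounded[OF k_integrable p, of mass] by blast
  have "Lp_norm (lebesgue_on S) p (nl_adj \<delta> \<mu> \<Omega> u) \<le> C * Lp_norm (lebesgue_on S) p u"
    if u: "u \<in> Lp (lebesgue_on S) p" for u
  proof -
    let ?u = "\<lambda>x. indicator \<Omega> x * u x"
    have T: "nl_adj \<delta> \<mu> \<Omega> u \<in> Lp lebesgue p"
      by (intro nl_adj_Lp p u)
    have "Lp_norm (lebesgue_on S) p (nl_adj \<delta> \<mu> \<Omega> u) \<le> Lp_norm lebesgue p (nl_adj \<delta> \<mu> \<Omega> u)"
      unfolding Lp_norm_lebesgue_on[OF S_sets p(2)]
      by (intro Lp_norm_mono[OF T] p Lp_measurable[OF Lp_indicator[OF T S_sets]]) (auto simp: indicator_def)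
    also have "\<dots> \<le> C * Lp_norm lebesgue p ?u"
      using C[OF zero_extension_\<Omega>[OF u]] by (simp add: nl_adj_eq[abs_def])
    also have "\<dots> \<le> C * Lp_norm (lebesgue_on S) p u"
      unfolding Lp_norm_lebesgue_on[OF S_sets p(2)] using \<open>0 \<le> C\<close>
      by (intro mult_left_mono Lp_norm_mono zero_extension_S u p Lp_measurable[OF zero_extension_\<Omega>[OF u]])
        (auto simp: indicator_def ext_domain_def)
    finally show ?thesis .
  qed
  then show "\<exists>C. \<forall>u\<in>Lp (lebesgue_on S) p. Lp_norm (lebesgue_on S) p (nl_adj \<delta> \<mu> \<Omega> u) \<le> C * Lp_norm (lebesgue_on S) p u"
    by blast
qed

text \<open>
  Duality of convolutions is applied to \<open>u\<close> cut off to \<open>\<Omega>\<close> and \<open>v\<close> cut off to \<open>S\<close>.  The factor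
  \<open>1\<^sub>\<Omega>\<close>, which the derivative carries on the outside, is the one that the adjoint carries on the
  argument.
\<close>

lemma nl_adj_duality:
  assumes p: "1 \<le> p" "p < \<infinity>" "1 / p + 1 / p' = 1"
    and u: "u \<in> Lp (lebesgue_on S) p" and v: "v \<in> Lp (lebesgue_on S) p'"
  shows "(LINT x|lebesgue_on S. nl_adj \<delta> \<mu> \<Omega> u x * v x) = (LINT x|lebesgue_on S. u x * nl_deriv \<delta> \<mu> \<Omega> v x)"
proof -
  note p' = conjugate_exponent_ge_1[OF p]
  let ?u = "\<lambda>x. indicator \<Omega> x * u x" and ?v = "\<lambda>x. indicator S x * v x"
  note u0 = zero_extension_\<Omega>[OF u] and v0 = zero_extension_S[OF v]
  have ua: "(\<lambda>x. \<bar>?u x\<bar>) \<in> Lp lebesgue p"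
    using Lp_measurable[OF u0] by (intro Lp_dominated[OF u0]) auto
  have ka: "integrable lebesgue (\<lambda>z. \<bar>k z\<bar>)"
    using k_integrable by simp
  have dual: "(LINT x|lebesgue. convolution k ?u x * ?v x) = (LINT x|lebesgue. ?u x * convolution k_refl ?v x)"
    by (intro convolution_duality convolution_Lp_AE_integrable[OF k_integrable u0 p(1)]
        Lp_pairing_integrable[OF p convolution_Lp[OF ka ua p(1)] v0]
        borel_measurable_integrable k_integrable Lp_measurable[OF u0] Lp_measurable[OF v0])
  have i1: "integrable lebesgue (\<lambda>x. convolution k ?u x * ?v x)"
    by (rule Lp_pairing_integrable[OF p convolution_Lp[OF k_integrable u0 p(1)] v0])
  have i2: "integrable lebesgue (\<lambda>x. ?u x * convolution k_refl ?v x)"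
    by (rule Lp_pairing_integrable[OF p u0 convolution_Lp[OF k_refl_integrable v0 p']])
  have i3: "integrable lebesgue (\<lambda>x. ?u x * ?v x)"
    by (rule Lp_pairing_integrable[OF p u0 v0])
  have "(LINT x|lebesgue_on S. nl_adj \<delta> \<mu> \<Omega> u x * v x)
      = (LINT x|lebesgue. convolution k ?u x * ?v x - mass * (?u x * ?v x))"
    by (simp add: integral_restrict_space nl_adj_eq algebra_simps)
  also have "\<dots> = (LINT x|lebesgue. ?u x * convolution k_refl ?v x - mass * (?u x * ?v x))"
    using i1 i2 i3 dual by simp
  also have "\<dots> = (LINT x|lebesgue. indicator S x * (u x * nl_deriv \<delta> \<mu> \<Omega> v x))"
  proof (rule integral_cong_AE)
    have "u \<in> borel_measurable (lebesgue_on S)" "nl_deriv \<delta> \<mu> \<Omega> v \<in> borel_measurable (lebesgue_on S)"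
      using u nl_deriv_Lp[OF p' v] by (auto intro: Lp_measurable Lp_restrict)
    then have "(\<lambda>x. u x * nl_deriv \<delta> \<mu> \<Omega> v x) \<in> borel_measurable (lebesgue_on S)"
      by measurable
    then show "(\<lambda>x. indicator S x * (u x * nl_deriv \<delta> \<mu> \<Omega> v x)) \<in> borel_measurable lebesgue"
      using S_sets by (simp add: borel_measurable_restrict_space_iff)
    show "AE x in lebesgue. ?u x * convolution k_refl ?v x - mass * (?u x * ?v x)
        = indicator S x * (u x * nl_deriv \<delta> \<mu> \<Omega> v x)"
      using nl_deriv_eq_AE[OF p' v]
    proof eventually_elim
      case (elim x)
      then show ?case
        unfolding elim by (auto simp: indicator_def ext_domain_def algebra_simps)
    qed
  qed (use i2 i3 in auto)
  also have "\<dots> = (LINT x|lebesgue_on S. u x * nl_deriv \<delta> \<mu> \<Omega> v x)"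
    by (simp add: integral_restrict_space)
  finally show ?thesis .
qed

end

section \<open>The adjoint of the nonlocal derivative\<close>

theorem theorem3p2:
  fixes \<Omega> :: "(real ^ 'n) set" and \<delta> :: real and \<mu> :: "real ^ 'n \<Rightarrow> real"
    and p p' :: ennreal
  defines "M \<equiv> lebesgue_on (ext_domain \<delta> \<Omega>)"
  assumes "open \<Omega>" and "bounded \<Omega>" and "\<delta> > 0"
    and "integrable lebesgue \<mu>" and "ess_support \<mu> \<subseteq> cball 0 \<delta>"
    and "1 \<le> p" and "p < \<infinity>" and "1 / p + 1 / p' = 1"
  shows "(\<forall>v\<in>Lp M p'. AE x in M. integrable M (nl_deriv_integrand \<delta> \<mu> \<Omega> v x)) \<and>
    operator_on_Lp M p' (nl_deriv \<delta> \<mu> \<Omega>) \<and>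
    (\<forall>u\<in>Lp M p. AE x in M. integrable M (nl_adj_integrand \<delta> \<mu> \<Omega> u x)) \<and>
    bounded_linear_on_Lp M p (nl_adj \<delta> \<mu> \<Omega>) \<and>
    (\<forall>u\<in>Lp M p. \<forall>v\<in>Lp M p'.
           integrable M (\<lambda>x. nl_adj \<delta> \<mu> \<Omega> u x * v x) \<and>
           integrable M (\<lambda>x. u x * nl_deriv \<delta> \<mu> \<Omega> v x) \<and>
           (LINT x|M. nl_adj \<delta> \<mu> \<Omega> u x * v x) = (LINT x|M. u x * nl_deriv \<delta> \<mu> \<Omega> v x))"
proof -
  interpret nonlocal_setting \<Omega> \<delta> \<mu>
    using assms by unfold_locales
  note p = \<open>1 \<le> p\<close> \<open>p < \<infinity>\<close> \<open>1 / p + 1 / p' = 1\<close>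
  note p' = conjugate_exponent_ge_1[OF p]
  show ?thesis
    unfolding M_def
  proof (intro conjI ballI)
    fix u v assume u: "u \<in> Lp (lebesgue_on S) p" and v: "v \<in> Lp (lebesgue_on S) p'"
    show "integrable (lebesgue_on S) (\<lambda>x. nl_adj \<delta> \<mu> \<Omega> u x * v x)"
      by (rule Lp_pairing_integrable[OF p Lp_restrict[OF nl_adj_Lp[OF p(1) u]] v])
    show "integrable (lebesgue_on S) (\<lambda>x. u x * nl_deriv \<delta> \<mu> \<Omega> v x)"
      by (rule Lp_pairing_integrable[OF p u Lp_restrict[OF nl_deriv_Lp[OF p' v]]])
    show "(LINT x|lebesgue_on S. nl_adj \<delta> \<mu> \<Omega> u x * v x) = (LINT x|lebesgue_on S. u x * nl_deriv \<delta> \<mu> \<Omega> v x)"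
      by (rule nl_adj_duality[OF p u v])
  next
    fix v assume v: "v \<in> Lp (lebesgue_on S) p'"
    show "AE x in lebesgue_on S. integrable (lebesgue_on S) (nl_deriv_integrand \<delta> \<mu> \<Omega> v x)"
      by (rule AE_restrict[OF nl_deriv_integrand_integrable_AE[OF p' v]])
  next
    fix u assume "u \<in> Lp (lebesgue_on S) p"
    then show "AE x in lebesgue_on S. integrable (lebesgue_on S) (nl_adj_integrand \<delta> \<mu> \<Omega> u x)"
      unfolding integrable_nl_adj_integrand_iff
      by (intro AE_restrict convolution_Lp_AE_integrable[OF k_integrable _ p(1)] zero_extension_\<Omega>)
  qed (use p in \<open>auto intro: nl_deriv_operator[OF p'] nl_adj_bounded_linear\<close>)
qed

end
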